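(* Let $A$ be a distance set. Then: (1) all spaces in $\mathcal{V}^\star_A$ are zero-dimensional if and only if $A$ does not contain a right neighborhood of $0$ (i.e. there is no $r>0$ with $[0,r] \subseteq A$); (2) all spaces in $\mathcal{V}^\star_A$ are ultrametric if and only if $A$ is well-spaced; (3) all spaces in $\mathcal{V}^\star_A$ are discrete if and only if they are all locally compact, if and only if they are all $\sigma$-compact, if and only if $0$ is isolated in $A$; (4) all spaces in $\mathcal{V}^\star_A$ are connected if and only if they are all compact, if and only if they are all singletons, if and only if $A = \{0\}$. Moreover, all four characterizations remain true if $\mathcal{V}^\star_A$ is replaced by $\mathcal{V}_A$.
   Context: $\mathbb{R}^+ = [0,\infty)$. A Polish metric space is a nonempty separable complete metric space. For a metric space $X$ let $D(X) = \{ d_X(x,y) \mid x,y \in X\}$. A set $A \subseteq \mathbb{R}^+$ is a distance set if $A = D(X)$ for some Polish metric space $X$. Let $\mathbb{U}$ be the Urysohn space and $F(\mathbb{U})$ the set of nonempty closed subsets of $\mathbb{U}$ (each a Polish metric space with the induced metric; every Polish metric space is isometric to a member of $F(\mathbb{U})$). For $A \subseteq \mathbb{R}^+$ put $\mathcal{V}_A = \{X \in F(\mathbb{U}) \mid D(X) \subseteq A\}$ and $\mathcal{V}^\star_A = \{X \in F(\mathbb{U}) \mid D(X) = A\}$. A set $A$ is well-spaced if for all $r,r' \in A$, $r < r'$ implies $2r < r'$. *)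

theory Defs
  imports "HOL-Analysis.Analysis"
begin

section \<open>Polish metric spaces and distance sets\<close>

definition polish_metric :: "'a metric \<Rightarrow> bool" where
  "polish_metric X \<longleftrightarrow>
     mspace X \<noteq> {} \<and> separable_space (mtopology_of X) \<and> mcomplete_of X"

definition dist_set :: "'a metric \<Rightarrow> real set" where
  "dist_set X = {mdist X x y | x y. x \<in> mspace X \<and> y \<in> mspace X}"

text \<open>
  HOL cannot quantify over types inside a formula. A Polish metric space has at most continuum many
  points, so up to isometry its carrier is a set of reals; hence quantifying over
  \<^typ>\<open>real metric\<close> covers all Polish metric spaces. This is made precise by
  \<open>polish_metric_isometric_copy\<close> below, and by its consequences \<open>distance_set_dist_set\<close> and
  \<open>urysohn_space_universal\<close>, in which the Polish metric space lives on an arbitrary type.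
\<close>

definition distance_set :: "real set \<Rightarrow> bool" where
  "distance_set A \<longleftrightarrow> (\<exists>X :: real metric. polish_metric X \<and> A = dist_set X)"

definition well_spaced :: "real set \<Rightarrow> bool" where
  "well_spaced A \<longleftrightarrow> (\<forall>r\<in>A. \<forall>r'\<in>A. r < r' \<longrightarrow> 2 * r < r')"

section \<open>The Urysohn space\<close>

definition isometric_on :: "'a set \<Rightarrow> 'a metric \<Rightarrow> 'b metric \<Rightarrow> ('a \<Rightarrow> 'b) \<Rightarrow> bool" where
  "isometric_on S X Y f \<longleftrightarrow>
     f \<in> S \<rightarrow> mspace Y \<and> (\<forall>x\<in>S. \<forall>y\<in>S. mdist Y (f x) (f y) = mdist X x y)"

definition ultrahomogeneous :: "'a metric \<Rightarrow> bool" where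
  "ultrahomogeneous X \<longleftrightarrow>
     (\<forall>S f. finite S \<and> S \<subseteq> mspace X \<and> isometric_on S X X f \<longrightarrow>
        (\<exists>g. isometric_on (mspace X) X X g \<and> g ` mspace X = mspace X \<and> (\<forall>x\<in>S. g x = f x)))"

text \<open>
  The Urysohn space is, up to isometry, the unique Polish metric space that is ultrahomogeneous and
  contains an isometric copy of every Polish metric space.
\<close>

definition urysohn_space :: "'a metric \<Rightarrow> bool" where
  "urysohn_space U \<longleftrightarrow>
     polish_metric U \<and> ultrahomogeneous U \<and>
     (\<forall>X :: real metric. polish_metric X \<longrightarrow> (\<exists>f. isometric_on (mspace X) X U f))"

definition closed_subspaces :: "'a metric \<Rightarrow> 'a set set" where
  "closed_subspaces U = {X. X \<noteq> {} \<and> closedin (mtopology_of U) X}"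

definition dist_sub :: "'a metric \<Rightarrow> real set \<Rightarrow> 'a set set" where
  "dist_sub U A = {X \<in> closed_subspaces U. dist_set (submetric U X) \<subseteq> A}"

definition dist_eq :: "'a metric \<Rightarrow> real set \<Rightarrow> 'a set set" where
  "dist_eq U A = {X \<in> closed_subspaces U. dist_set (submetric U X) = A}"

section \<open>Properties of metric spaces\<close>

definition zero_dimensional :: "'a metric \<Rightarrow> bool" where
  "zero_dimensional X \<longleftrightarrow> mtopology_of X dim_le 0"

definition ultrametric :: "'a metric \<Rightarrow> bool" where
  "ultrametric X \<longleftrightarrow>
     (\<forall>x\<in>mspace X. \<forall>y\<in>mspace X. \<forall>z\<in>mspace X.
        mdist X x z \<le> max (mdist X x y) (mdist X y z))"

definition discrete_metric_space :: "'a metric \<Rightarrow> bool" where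
  "discrete_metric_space X \<longleftrightarrow> mtopology_of X = discrete_topology (mspace X)"

definition sigma_compact_space :: "'a topology \<Rightarrow> bool" where
  "sigma_compact_space T \<longleftrightarrow>
     (\<exists>K :: nat \<Rightarrow> 'a set. (\<forall>n. compactin T (K n)) \<and> topspace T = (\<Union>n. K n))"

section \<open>Independence of the carrier type\<close>

lemma separable_imp_inj_real:
  fixes X :: "'a metric"
  assumes "separable_space (mtopology_of X)"
  shows "\<exists>h :: 'a \<Rightarrow> real. inj_on h (mspace X)"
proof -
  obtain C where C: "countable C" "C \<subseteq> mspace X" "(mtopology_of X) closure_of C = mspace X"
    using assms by (auto simp: separable_space_def)
  define e where "e = (to_nat_on (C \<times> (UNIV :: rat set)) :: 'a \<times> rat \<Rightarrow> nat)"
  have inje: "inj_on e (C \<times> UNIV)"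
    unfolding e_def using C(1) by (intro inj_on_to_nat_on) auto
  define k where "k x = e ` {(c, q). c \<in> C \<and> mdist X x c < real_of_rat q}" for x
  have "inj_on k (mspace X)"
  proof (rule inj_onI, rule ccontr)
    fix x y assume xy: "x \<in> mspace X" "y \<in> mspace X" "k x = k y" "x \<noteq> y"
    define r where "r = mdist X x y"
    have r: "r > 0"
      using xy mdist_nonneg[of X x y] mdist_zero[of x X y] unfolding r_def by linarith
    have "x \<in> (mtopology_of X) closure_of C"
      using xy C by simp
    then obtain c where c: "c \<in> C" "mdist X x c < r / 2"
      using r by (fastforce simp: mtopology_of_def
          Metric_space.metric_closure_of[OF Metric_space_mspace_mdist]
          Metric_space.in_mball[OF Metric_space_mspace_mdist] dest: spec[of _ "r / 2"])
    obtain q where q: "mdist X x c < real_of_rat q" "real_of_rat q < r / 2"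
      using c(2) of_rat_dense by blast
    have "e (c, q) \<in> k y"
      using c(1) q(1) xy(3) unfolding k_def by blast
    then obtain c' q' where cq: "e (c, q) = e (c', q')" "c' \<in> C" "mdist X y c' < real_of_rat q'"
      unfolding k_def by blast
    then have "(c, q) = (c', q')"
      using inj_onD[OF inje cq(1)] c(1) by simp
    then have "mdist X y c < real_of_rat q"
      using cq(3) by simp
    moreover have "r \<le> mdist X x c + mdist X c y"
      unfolding r_def using xy c C by (intro mdist_triangle) auto
    ultimately show False
      using q mdist_commute[of X c y] by linarith
  qed
  moreover obtain j :: "nat set \<Rightarrow> real" where "inj j"
    using nat_sets_eqpoll_reals unfolding eqpoll_def bij_betw_def by blast
  ultimately have "inj_on (j \<circ> k) (mspace X)"
    by (meson comp_inj_on inj_on_subset subset_UNIV)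
  then show ?thesis by blast
qed

lemma polish_metric_isometric_copy:
  fixes X :: "'a metric"
  assumes X: "polish_metric X"
  shows "\<exists>(Y :: real metric) h. polish_metric Y \<and> isometric_on (mspace X) X Y h
           \<and> h ` mspace X = mspace Y"
proof -
  obtain h :: "'a \<Rightarrow> real" where h: "inj_on h (mspace X)"
    using separable_imp_inj_real X unfolding polish_metric_def by blast
  define g where "g = inv_into (mspace X) h"
  have gh: "g (h x) = x" if "x \<in> mspace X" for x
    using that h unfolding g_def by simp
  define d where "d a b = mdist X (g a) (g b)" for a b
  have MS: "Metric_space (h ` mspace X) d"
    by unfold_locales (auto simp: d_def gh mdist_commute mdist_triangle)
  interpret A: Metric_space "mspace X" "mdist X" by simp
  interpret B: Metric_space "h ` mspace X" d by (rule MS)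
  interpret AB: Metric_space12 "mspace X" "mdist X" "h ` mspace X" d
    by (simp add: Metric_space12_def MS)
  define Y where "Y = metric (h ` mspace X, d)"
  have Y: "mspace Y = h ` mspace X" "mdist Y = d" "mtopology_of Y = B.mtopology"
    by (simp_all add: Y_def)
  have iso: "isometric_on (mspace X) X Y h"
    by (auto simp: isometric_on_def Y d_def gh)
  have "homeomorphic_map A.mtopology B.mtopology h"
    by (rule AB.isometry_imp_homeomorphic_map) (auto simp: d_def gh)
  then have "A.mtopology homeomorphic_space B.mtopology"
    by (rule homeomorphic_map_imp_homeomorphic_space)
  then have sep: "separable_space (mtopology_of Y)"
    using homeomorphic_separable_space[of A.mtopology B.mtopology] X
    by (simp add: polish_metric_def Y(3)) (simp add: mtopology_of_def)
  have "B.mcomplete"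
    unfolding B.mcomplete_def
  proof (intro allI impI)
    fix s assume s: "B.MCauchy s"
    have rs: "s n \<in> h ` mspace X" for n
      using s unfolding B.MCauchy_def by auto
    then have gs: "g (s n) \<in> mspace X" "h (g (s n)) = s n" for n
      using gh by (metis imageE)+
    have "A.MCauchy (g \<circ> s)"
      using s gs unfolding A.MCauchy_def B.MCauchy_def d_def by auto
    moreover have "A.mcomplete"
      using X unfolding polish_metric_def mcomplete_of_def by simp
    ultimately obtain x where x: "limitin A.mtopology (g \<circ> s) x sequentially"
      unfolding A.mcomplete_def by blast
    then have "limitin B.mtopology s (h x) sequentially"
      unfolding A.limit_metric_sequentially B.limit_metric_sequentially
      by (auto simp: rs gh d_def gs)
    then show "\<exists>x. limitin B.mtopology s x sequentially" by blast
  qed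
  then have "mcomplete_of Y"
    by (simp add: Y_def)
  then have "polish_metric Y"
    using sep X unfolding polish_metric_def by (simp add: Y)
  then show ?thesis
    using iso Y(1) by metis
qed

lemma dist_set_isometric:
  assumes "isometric_on (mspace X) X Y h" "h ` mspace X = mspace Y"
  shows "dist_set Y = dist_set X"
proof -
  have "mdist Y (h x) (h y) = mdist X x y" if "x \<in> mspace X" "y \<in> mspace X" for x y
    using assms(1) that by (simp add: isometric_on_def)
  then show ?thesis
    unfolding dist_set_def assms(2)[symmetric] by (auto; metis imageI)
qed

lemma distance_set_dist_set:
  fixes X :: "'a metric"
  assumes "polish_metric X"
  shows "distance_set (dist_set X)"
  using polish_metric_isometric_copy[OF assms] dist_set_isometric
  unfolding distance_set_def by metis

lemma urysohn_space_universal: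
  fixes X :: "'a metric" and U :: "'b metric"
  assumes U: "urysohn_space U" and X: "polish_metric X"
  shows "\<exists>f. isometric_on (mspace X) X U f"
proof -
  obtain Y :: "real metric" and h where Y: "polish_metric Y" "isometric_on (mspace X) X Y h"
    using polish_metric_isometric_copy[OF X] by blast
  obtain f where "isometric_on (mspace Y) Y U f"
    using U Y unfolding urysohn_space_def by blast
  then have "isometric_on (mspace X) X U (f \<circ> h)"
    using Y(2) unfolding isometric_on_def by (auto simp: Pi_iff)
  then show ?thesis by blast
qed

end

theory Submission
  imports Defs
begin

text \<open>
  Let \<open>D(X) = A\<close> and let \<open>Y\<close> be a Polish metric space with \<open>D(Y) \<subseteq> A\<close>. The product \<open>X \<times> Y\<close> with the
  maximum metric is Polish, has distance set exactly \<open>A\<close>, and retracts onto an isometric copy of \<open>Y\<close>;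
  by universality it lives inside the Urysohn space as a closed set. So whenever the condition on
  \<open>A\<close> fails, it suffices to find a test space \<open>Y\<close> with distances in \<open>A\<close> that lacks the property: an
  interval \<open>[0,r]\<close>; three points at distances \<open>r, r, r'\<close> with \<open>r < r' \<le> 2r\<close>; the Baire space with
  distance \<open>a n\<close> between sequences first differing at \<open>n\<close>, where \<open>a n \<in> A\<close> decreases to \<open>0\<close>; or
  infinitely many points at a common distance. Conversely, a radius outside \<open>A\<close> makes balls clopen.
\<close>

section \<open>Polish metric spaces in terms of the distance\<close>

text \<open>Epsilon forms of separability and completeness, so that products, isometric images and
  test spaces can be checked by estimating distances.\<close>

lemma separable_mtopology_of_iff:
  "separable_space (mtopology_of X) \<longleftrightarrow>
     (\<exists>C\<subseteq>mspace X. countable C \<and> (\<forall>x\<in>mspace X. \<forall>e>0. \<exists>c\<in>C. mdist X x c < e))"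
proof -
  interpret X: Metric_space "mspace X" "mdist X" by simp
  have "(mtopology_of X) closure_of C = mspace X \<longleftrightarrow>
      (\<forall>x\<in>mspace X. \<forall>e>0. \<exists>c\<in>C. mdist X x c < e)" if "C \<subseteq> mspace X" for C
  proof -
    have "(\<exists>y\<in>C. y \<in> X.mball x e) \<longleftrightarrow> (\<exists>c\<in>C. mdist X x c < e)" if "x \<in> mspace X" for x e
      using that \<open>C \<subseteq> mspace X\<close> by (intro bex_cong) auto
    then have closure: "X.mtopology closure_of C = {x \<in> mspace X. \<forall>e>0. \<exists>c\<in>C. mdist X x c < e}"
      unfolding X.metric_closure_of by (simp cong: conj_cong)
    show ?thesis
      unfolding mtopology_of_def closure by auto
  qed
  then show ?thesis
    unfolding separable_space_def topspace_mtopology_of by blast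
qed

lemma mcomplete_of_iff:
  fixes X :: "'a metric"
  shows "mcomplete_of X \<longleftrightarrow>
     (\<forall>s :: nat \<Rightarrow> 'a. (\<forall>n. s n \<in> mspace X) \<and> (\<forall>e>0. \<exists>N. \<forall>m\<ge>N. \<forall>n\<ge>N. mdist X (s m) (s n) < e) \<longrightarrow>
        (\<exists>l\<in>mspace X. \<forall>e>0. \<exists>N. \<forall>n\<ge>N. mdist X (s n) l < e))"
proof -
  interpret X: Metric_space "mspace X" "mdist X" by simp
  have cauchy: "X.MCauchy s \<longleftrightarrow>
      (\<forall>n. s n \<in> mspace X) \<and> (\<forall>e>0. \<exists>N. \<forall>m\<ge>N. \<forall>n\<ge>N. mdist X (s m) (s n) < e)" for s
    unfolding X.MCauchy_def by (simp add: image_subset_iff)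
  have lim: "limitin X.mtopology s l sequentially \<longleftrightarrow>
      l \<in> mspace X \<and> (\<forall>e>0. \<exists>N. \<forall>n\<ge>N. mdist X (s n) l < e)"
    if "\<forall>n. s n \<in> mspace X" for s l
    using that unfolding X.limit_metric_sequentially by auto
  have "(\<exists>l. limitin X.mtopology s l sequentially) \<longleftrightarrow>
      (\<exists>l\<in>mspace X. \<forall>e>0. \<exists>N. \<forall>n\<ge>N. mdist X (s n) l < e)"
    if "\<forall>n. s n \<in> mspace X" for s
    using lim[OF that] by blast
  then show ?thesis
    unfolding mcomplete_of_def X.mcomplete_def cauchy by (simp add: imp_conjL)
qed

lemma mdist_self: "x \<in> mspace X \<Longrightarrow> mdist X x x = 0"
  by simp

lemma dist_setI: "x \<in> mspace X \<Longrightarrow> y \<in> mspace X \<Longrightarrow> mdist X x y \<in> dist_set X"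
  unfolding dist_set_def by blast

lemma dist_set_nonneg: "r \<in> dist_set X \<Longrightarrow> 0 \<le> r"
  unfolding dist_set_def by auto

lemma zero_in_dist_set: "x \<in> mspace X \<Longrightarrow> 0 \<in> dist_set X"
  using dist_setI[of x X x] by (simp add: mdist_self)

lemma mtopology_of_eq_discrete:
  assumes "e > 0"
    and "\<And>x y. x \<in> mspace X \<Longrightarrow> y \<in> mspace X \<Longrightarrow> x \<noteq> y \<Longrightarrow> e \<le> mdist X x y"
  shows "mtopology_of X = discrete_topology (mspace X)"
proof -
  interpret X: Metric_space "mspace X" "mdist X" by simp
  have "openin X.mtopology {x}" if x: "x \<in> mspace X" for x
  proof -
    have "y = x" if "y \<in> X.mball x e" for y
      using that assms(2)[OF x, of y] by (cases "x = y") auto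
    moreover have "x \<in> X.mball x e"
      using x assms(1) by simp
    ultimately have "X.mball x e = {x}"
      by blast
    then show ?thesis
      using X.openin_mball[of x e] by simp
  qed
  then show ?thesis
    unfolding mtopology_of_def
    using discrete_topology_unique[of "mspace X" X.mtopology] by simp
qed

text \<open>Countability gives separability of the discrete topology, and a Cauchy sequence is
  constant once its terms are closer than the gap \<open>e\<close>.\<close>

lemma polish_metric_uniformly_discrete:
  assumes "e > 0" "countable (mspace X)" "mspace X \<noteq> {}"
    and sep: "\<And>x y. x \<in> mspace X \<Longrightarrow> y \<in> mspace X \<Longrightarrow> x \<noteq> y \<Longrightarrow> e \<le> mdist X x y"
  shows "polish_metric X"
  unfolding polish_metric_def mcomplete_of_iff
proof (intro conjI allI impI)
  show "separable_space (mtopology_of X)"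
    using mtopology_of_eq_discrete[OF assms(1) sep] assms(2)
    by (simp add: separable_space_discrete_topology)
  fix s :: "nat \<Rightarrow> _" assume s: "(\<forall>n. s n \<in> mspace X) \<and>
    (\<forall>e>0. \<exists>N. \<forall>m\<ge>N. \<forall>n\<ge>N. mdist X (s m) (s n) < e)"
  from s have sX: "\<And>n. s n \<in> mspace X"
    by simp
  from s assms(1) have "\<exists>N. \<forall>m\<ge>N. \<forall>n\<ge>N. mdist X (s m) (s n) < e"
    by simp
  then obtain N where N: "\<forall>m\<ge>N. \<forall>n\<ge>N. mdist X (s m) (s n) < e" ..
  have const: "s n = s N" if "n \<ge> N" for n
  proof (rule ccontr)
    assume "s n \<noteq> s N"
    then have "e \<le> mdist X (s n) (s N)" by (intro sep sX)
    moreover have "mdist X (s n) (s N) < e" using N[rule_format, OF that order_refl] .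
    ultimately show False by simp
  qed
  show "\<exists>l\<in>mspace X. \<forall>e>0. \<exists>N. \<forall>n\<ge>N. mdist X (s n) l < e"
  proof (intro bexI[of _ "s N"] allI impI exI[of _ N])
    show "mdist X (s n) (s N) < e" if "e > 0" "n \<ge> N" for n e
      using const[OF that(2)] that(1) sX by (simp add: mdist_self)
  qed (rule sX)
qed (fact assms)

section \<open>Products with the maximum metric\<close>

text \<open>The maximum, unlike a sum or the Euclidean combination, takes only values that are
  already distances in one of the factors.\<close>

definition max_prod :: "'a metric \<Rightarrow> 'b metric \<Rightarrow> ('a \<times> 'b) metric" where
  "max_prod X Y = metric (mspace X \<times> mspace Y,
     \<lambda>p q. max (mdist X (fst p) (fst q)) (mdist Y (snd p) (snd q)))"

lemma Metric_space_max_prod: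
  "Metric_space (mspace X \<times> mspace Y)
     (\<lambda>p q. max (mdist X (fst p) (fst q)) (mdist Y (snd p) (snd q)))"
proof
  fix p q assume "p \<in> mspace X \<times> mspace Y" "q \<in> mspace X \<times> mspace Y"
  then have "mdist X (fst p) (fst q) = 0 \<longleftrightarrow> fst p = fst q"
    "mdist Y (snd p) (snd q) = 0 \<longleftrightarrow> snd p = snd q"
    by auto
  then show "max (mdist X (fst p) (fst q)) (mdist Y (snd p) (snd q)) = 0 \<longleftrightarrow> p = q"
    using mdist_nonneg[of X "fst p" "fst q"] mdist_nonneg[of Y "snd p" "snd q"]
    unfolding prod_eq_iff by linarith
next
  fix p q r
  assume "p \<in> mspace X \<times> mspace Y" "q \<in> mspace X \<times> mspace Y" "r \<in> mspace X \<times> mspace Y"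
  then show "max (mdist X (fst p) (fst r)) (mdist Y (snd p) (snd r))
    \<le> max (mdist X (fst p) (fst q)) (mdist Y (snd p) (snd q))
      + max (mdist X (fst q) (fst r)) (mdist Y (snd q) (snd r))"
    using mdist_triangle[of "fst p" X "fst q" "fst r"] mdist_triangle[of "snd p" Y "snd q" "snd r"]
    by (auto simp: mem_Times_iff)
qed (auto simp: mdist_commute le_max_iff_disj)

lemma mspace_max_prod [simp]: "mspace (max_prod X Y) = mspace X \<times> mspace Y"
  unfolding max_prod_def by (simp add: Metric_space.mspace_metric[OF Metric_space_max_prod])

lemma mdist_max_prod [simp]:
  "mdist (max_prod X Y) p q = max (mdist X (fst p) (fst q)) (mdist Y (snd p) (snd q))"
  unfolding max_prod_def by (simp add: Metric_space.mdist_metric[OF Metric_space_max_prod])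

text \<open>A maximum is below \<open>e\<close> iff both entries are, so density and convergence can
  be treated coordinatewise.\<close>

lemma polish_metric_max_prod:
  assumes X: "polish_metric X" and Y: "polish_metric Y"
  shows "polish_metric (max_prod X Y)"
proof -
  have "separable_space (mtopology_of (max_prod X Y))"
  proof -
    obtain C where C: "C \<subseteq> mspace X" "countable C"
      "\<And>x e. x \<in> mspace X \<Longrightarrow> e > 0 \<Longrightarrow> \<exists>c\<in>C. mdist X x c < e"
      using X unfolding polish_metric_def separable_mtopology_of_iff by blast
    obtain D where D: "D \<subseteq> mspace Y" "countable D"
      "\<And>x e. x \<in> mspace Y \<Longrightarrow> e > 0 \<Longrightarrow> \<exists>c\<in>D. mdist Y x c < e"
      using Y unfolding polish_metric_def separable_mtopology_of_iff by blast
    have "\<exists>c\<in>C \<times> D. mdist (max_prod X Y) p c < e"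
      if p: "p \<in> mspace X \<times> mspace Y" and "e > 0" for p e
    proof -
      obtain c where "c \<in> C" "mdist X (fst p) c < e"
        using C(3)[of "fst p" e] p \<open>e > 0\<close> by auto
      moreover obtain d where "d \<in> D" "mdist Y (snd p) d < e"
        using D(3)[of "snd p" e] p \<open>e > 0\<close> by auto
      ultimately show ?thesis
        by (intro bexI[of _ "(c, d)"]) auto
    qed
    then show ?thesis
      unfolding separable_mtopology_of_iff using C D
      by (intro exI[of _ "C \<times> D"]) auto
  qed
  moreover have "mcomplete_of (max_prod X Y)"
    unfolding mcomplete_of_iff
  proof (intro allI impI)
    have cX: "mcomplete_of X" and cY: "mcomplete_of Y"
      using X Y unfolding polish_metric_def by auto
    fix s :: "nat \<Rightarrow> _"
    assume s: "(\<forall>n. s n \<in> mspace (max_prod X Y)) \<and>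
      (\<forall>e>0. \<exists>N. \<forall>m\<ge>N. \<forall>n\<ge>N. mdist (max_prod X Y) (s m) (s n) < e)"
    then have "(\<forall>n. fst (s n) \<in> mspace X) \<and>
        (\<forall>e>0. \<exists>N. \<forall>m\<ge>N. \<forall>n\<ge>N. mdist X (fst (s m)) (fst (s n)) < e)"
      by (simp add: mem_Times_iff) blast
    then obtain l where l: "l \<in> mspace X" "\<And>e. e > 0 \<Longrightarrow> \<exists>N. \<forall>n\<ge>N. mdist X (fst (s n)) l < e"
      using mcomplete_of_iff[THEN iffD1, OF cX, THEN spec[of _ "\<lambda>n. fst (s n)"], THEN mp] by blast
    have "(\<forall>n. snd (s n) \<in> mspace Y) \<and>
        (\<forall>e>0. \<exists>N. \<forall>m\<ge>N. \<forall>n\<ge>N. mdist Y (snd (s m)) (snd (s n)) < e)"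
      using s by (simp add: mem_Times_iff) blast
    then obtain k where k: "k \<in> mspace Y" "\<And>e. e > 0 \<Longrightarrow> \<exists>N. \<forall>n\<ge>N. mdist Y (snd (s n)) k < e"
      using mcomplete_of_iff[THEN iffD1, OF cY, THEN spec[of _ "\<lambda>n. snd (s n)"], THEN mp] by blast
    have "\<exists>N. \<forall>n\<ge>N. mdist (max_prod X Y) (s n) (l, k) < e" if "e > 0" for e
    proof -
      obtain N M where "\<forall>n\<ge>N. mdist X (fst (s n)) l < e" "\<forall>n\<ge>M. mdist Y (snd (s n)) k < e"
        using l(2)[OF \<open>e > 0\<close>] k(2)[OF \<open>e > 0\<close>] by blast
      then show ?thesis
        by (intro exI[of _ "max N M"]) auto
    qed
    then show "\<exists>l\<in>mspace (max_prod X Y). \<forall>e>0. \<exists>N. \<forall>n\<ge>N. mdist (max_prod X Y) (s n) l < e"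
      using l(1) k(1) by (intro bexI[of _ "(l, k)"]) auto
  qed
  ultimately show ?thesis
    using X Y unfolding polish_metric_def by simp
qed

text \<open>Each distance in the product is a distance in \<open>X\<close> or in \<open>Y\<close>;
  conversely, pairs with a common second coordinate realise every distance of
  \<open>X\<close>.\<close>

lemma dist_set_max_prod:
  assumes "mspace Y \<noteq> {}" "dist_set Y \<subseteq> dist_set X"
  shows "dist_set (max_prod X Y) = dist_set X"
proof
  show "dist_set (max_prod X Y) \<subseteq> dist_set X"
  proof
    fix r assume "r \<in> dist_set (max_prod X Y)"
    then obtain p q where pq: "p \<in> mspace X \<times> mspace Y" "q \<in> mspace X \<times> mspace Y"
      "r = max (mdist X (fst p) (fst q)) (mdist Y (snd p) (snd q))"
      unfolding dist_set_def by auto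
    have "mdist X (fst p) (fst q) \<in> dist_set X" "mdist Y (snd p) (snd q) \<in> dist_set X"
      using pq(1,2) dist_setI[of "fst p" X] dist_setI[of "snd p" Y] assms(2)
      by (auto simp: mem_Times_iff)
    then show "r \<in> dist_set X"
      unfolding pq(3) max_def by simp
  qed
next
  obtain y where y: "y \<in> mspace Y" using assms(1) by blast
  show "dist_set X \<subseteq> dist_set (max_prod X Y)"
  proof
    fix r assume "r \<in> dist_set X"
    then obtain x x' where x: "x \<in> mspace X" "x' \<in> mspace X" "r = mdist X x x'"
      unfolding dist_set_def by blast
    then have "r = mdist (max_prod X Y) (x, y) (x', y)"
      using y by (simp add: mdist_self)
    then show "r \<in> dist_set (max_prod X Y)"
      using dist_setI[of "(x, y)" "max_prod X Y" "(x', y)"] x y by simp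
  qed
qed

section \<open>Retracts of subspaces of the Urysohn space\<close>

text \<open>A sequence in the image that converges in \<open>U\<close> is Cauchy, so its preimages
  are Cauchy in \<open>Z\<close> and converge there; uniqueness of limits puts the original limit
  into the image.\<close>

lemma closedin_isometric_image:
  assumes "mcomplete_of Z" and f: "isometric_on (mspace Z) Z U f"
  shows "closedin (mtopology_of U) (f ` mspace Z)"
proof -
  interpret U: Metric_space "mspace U" "mdist U" by simp
  have iso: "\<And>x y. x \<in> mspace Z \<Longrightarrow> y \<in> mspace Z \<Longrightarrow> mdist U (f x) (f y) = mdist Z x y"
    and img: "f ` mspace Z \<subseteq> mspace U"
    using f unfolding isometric_on_def by auto
  have "l \<in> f ` mspace Z"
    if s: "range s \<subseteq> f ` mspace Z" and l: "limitin U.mtopology s l sequentially" for s l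
  proof -
    define t where "t n = inv_into (mspace Z) f (s n)" for n
    have t: "t n \<in> mspace Z" "f (t n) = s n" for n
      using s unfolding t_def by (auto simp: inv_into_into f_inv_into_f range_subsetD)
    have "U.MCauchy s"
      using U.convergent_imp_MCauchy[OF order_trans[OF s img] l] .
    then have "\<forall>e>0. \<exists>N. \<forall>m\<ge>N. \<forall>n\<ge>N. mdist Z (t m) (t n) < e"
      using iso[OF t(1) t(1)] by (simp add: U.MCauchy_def t(2))
    then obtain z where z: "z \<in> mspace Z" "\<And>e. e > 0 \<Longrightarrow> \<exists>N. \<forall>n\<ge>N. mdist Z (t n) z < e"
      using assms(1)[unfolded mcomplete_of_iff, THEN spec[of _ t], THEN mp] t(1) by blast
    have "limitin U.mtopology s (f z) sequentially"
      unfolding U.limit_metric_sequentially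
    proof (intro conjI allI impI)
      show "f z \<in> mspace U" using z(1) img by blast
      fix e :: real assume "e > 0"
      then obtain N where "\<forall>n\<ge>N. mdist Z (t n) z < e" using z(2) by blast
      then show "\<exists>N. \<forall>n\<ge>N. s n \<in> mspace U \<and> mdist U (s n) (f z) < e"
        unfolding t(2)[symmetric] iso[OF t(1) z(1)] using img t(1) by blast
    qed
    then have "l = f z"
      using l U.limitin_metric_unique trivial_limit_sequentially by blast
    then show ?thesis using z(1) by blast
  qed
  then show ?thesis
    unfolding mtopology_of_def U.metric_closedin_iff_sequentially_closed using img by blast
qed

text \<open>The source of all counterexamples. \<open>S\<close> is the copy of the product in
  \<open>U\<close>, \<open>p\<close> the projection to \<open>Y\<close>, and \<open>g\<close> the
  slice over a fixed point of \<open>X\<close>. The retraction transports topological properties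
  from \<open>S\<close> to \<open>Y\<close>; the isometry \<open>g\<close> transports the
  ultrametric inequality, which is not topological.\<close>

lemma dist_eq_retraction:
  fixes X :: "'a metric" and Y :: "'b metric" and U :: "'u metric"
  assumes U: "urysohn_space U" and X: "polish_metric X" and Y: "polish_metric Y"
    and D: "dist_set Y \<subseteq> dist_set X"
  shows "\<exists>S\<in>dist_eq U (dist_set X). \<exists>p g.
    isometric_on (mspace Y) Y (submetric U S) g \<and>
    retraction_maps (mtopology_of (submetric U S)) (mtopology_of Y) p g"
proof -
  let ?Z = "max_prod X Y"
  have Z: "polish_metric ?Z" by (rule polish_metric_max_prod[OF X Y])
  obtain f where f: "isometric_on (mspace ?Z) ?Z U f"
    using urysohn_space_universal[OF U Z] by blast
  then have iso: "\<And>p q. p \<in> mspace ?Z \<Longrightarrow> q \<in> mspace ?Z \<Longrightarrow> mdist U (f p) (f q) = mdist ?Z p q"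
    and img: "f ` mspace ?Z \<subseteq> mspace U"
    unfolding isometric_on_def by auto
  have inj: "inj_on f (mspace ?Z)"
    by (rule inj_onI) (metis iso mdist_zero)
  define S where "S = f ` mspace ?Z"
  \<comment> \<open>\<open>f\<close> preserves distances and is therefore injective, so the
    coordinates of a point of \<open>S\<close> can be recovered.\<close>
  define p where "p u = snd (inv_into (mspace ?Z) f u)" for u
  have pf: "p (f q) = snd q" if "q \<in> mspace ?Z" for q
    unfolding p_def using inj that by simp
  obtain x0 where x0: "x0 \<in> mspace X" using X unfolding polish_metric_def by blast
  define g where "g y = f (x0, y)" for y
  have mS: "mspace (submetric U S) = S"
    using img unfolding S_def by auto
  have "closedin (mtopology_of U) S"
    unfolding S_def using Z f by (intro closedin_isometric_image) (auto simp: polish_metric_def)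
  moreover have "S \<noteq> {}"
    unfolding S_def using Z by (simp add: polish_metric_def)
  moreover have "dist_set (submetric U S) = dist_set ?Z"
    by (rule dist_set_isometric[of _ _ f]) (use f mS in \<open>auto simp: isometric_on_def S_def\<close>)
  moreover have "dist_set ?Z = dist_set X"
    using Y D by (intro dist_set_max_prod) (auto simp: polish_metric_def)
  ultimately have "S \<in> dist_eq U (dist_set X)"
    unfolding dist_eq_def closed_subspaces_def by simp
  moreover have gS: "g y \<in> S" if "y \<in> mspace Y" for y
    unfolding g_def S_def using that x0 by simp
  have giso: "mdist U (g y) (g y') = mdist Y y y'" if "y \<in> mspace Y" "y' \<in> mspace Y" for y y'
    unfolding g_def using that x0 iso[of "(x0, y)" "(x0, y')"]
    by (simp add: mdist_self)
  have "isometric_on (mspace Y) Y (submetric U S) g"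
    unfolding isometric_on_def using gS giso mS by auto
  moreover have "retraction_maps (mtopology_of (submetric U S)) (mtopology_of Y) p g"
    unfolding retraction_maps_def
  proof (intro conjI ballI)
    \<comment> \<open>The distance of second coordinates is bounded by the maximum, hence the
      Lipschitz constant \<open>1\<close>.\<close>
    have "Lipschitz_continuous_map (submetric U S) Y p"
      unfolding Lipschitz_continuous_map_def mS mdist_submetric
    proof (intro conjI exI[of _ 1] ballI Pi_I)
      fix u v assume "u \<in> S" "v \<in> S"
      then obtain a b where ab: "a \<in> mspace ?Z" "b \<in> mspace ?Z" "u = f a" "v = f b"
        unfolding S_def by blast
      then show "mdist Y (p u) (p v) \<le> 1 * mdist U u v"
        using pf iso by simp
    next
      fix u assume "u \<in> S"
      then show "p u \<in> mspace Y" unfolding S_def using pf by auto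
    qed
    then show "continuous_map (mtopology_of (submetric U S)) (mtopology_of Y) p"
      by (rule Lipschitz_continuous_imp_continuous_map)
    have "Lipschitz_continuous_map Y (submetric U S) g"
      unfolding Lipschitz_continuous_map_def mS mdist_submetric
      using gS giso by (intro conjI exI[of _ 1]) auto
    then show "continuous_map (mtopology_of Y) (mtopology_of (submetric U S)) g"
      by (rule Lipschitz_continuous_imp_continuous_map)
    fix y assume "y \<in> topspace (mtopology_of Y)"
    then show "p (g y) = y"
      unfolding g_def using pf[of "(x0, y)"] x0 by simp
  qed
  ultimately show ?thesis by blast
qed

lemma sigma_compact_space_continuous_map_image:
  assumes "sigma_compact_space S" "continuous_map S T f" "f ` topspace S = topspace T"
  shows "sigma_compact_space T"
proof -
  obtain K where K: "\<And>n. compactin S (K n)" "topspace S = (\<Union>n::nat. K n)"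
    using assms(1) unfolding sigma_compact_space_def by blast
  have "compactin T (f ` K n)" for n
    using K(1) assms(2) by (rule image_compactin)
  moreover have "topspace T = (\<Union>n. f ` K n)"
    unfolding assms(3)[symmetric] K(2) by (rule image_UN)
  ultimately show ?thesis
    unfolding sigma_compact_space_def by (intro exI[of _ "\<lambda>n. f ` K n"]) simp
qed

section \<open>Properties forced by the distance set\<close>

text \<open>Clopen sets are open, so they serve as their own inner open sets in a neighbourhood
  base.\<close>

lemma dim_le_0_iff:
  "T dim_le 0 \<longleftrightarrow> (\<forall>W x. openin T W \<and> x \<in> W \<longrightarrow>
     (\<exists>B. (closedin T B \<and> openin T B) \<and> x \<in> B \<and> B \<subseteq> W))"
  unfolding dimension_le_0_neighbourhood_base_of_clopen
  by (rule open_neighbourhood_base_of) simp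

text \<open>For \<open>r \<notin> A\<close> no point is at distance exactly \<open>r\<close> from
  the centre, so the open and the closed ball of radius \<open>r\<close> coincide. Such radii exist
  arbitrarily close to \<open>0\<close>.\<close>

lemma zero_dimensional_if_no_interval:
  assumes "\<not> (\<exists>r>0. {0..r} \<subseteq> A)" "dist_set X \<subseteq> A"
  shows "zero_dimensional X"
proof -
  interpret X: Metric_space "mspace X" "mdist X" by simp
  have "\<exists>B. (closedin X.mtopology B \<and> openin X.mtopology B) \<and> x \<in> B \<and> B \<subseteq> W"
    if W: "openin X.mtopology W" "x \<in> W" for W x
  proof -
    obtain e where e: "e > 0" "X.mball x e \<subseteq> W"
      using W unfolding X.openin_mtopology by blast
    have x: "x \<in> mspace X"
      using W unfolding X.openin_mtopology by blast
    have "\<not> {0..e/2} \<subseteq> A" using assms(1) e(1) half_gt_zero by blast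
    then obtain r where r: "0 \<le> r" "r \<le> e/2" "r \<notin> A" by (meson atLeastAtMost_iff subsetI)
    \<comment> \<open>This rules out \<open>0\<close> as the missing radius, so the ball of radius
      \<open>r\<close> contains its centre.\<close>
    have "0 \<in> A" using zero_in_dist_set[OF x] assms(2) by (rule rev_subsetD)
    then have "0 < r" using r(1,3) by (cases "r = 0") auto
    have "mdist X x y \<le> r \<longleftrightarrow> mdist X x y < r" if "y \<in> mspace X" for y
      using dist_setI[OF x that] assms(2) r(3) by (metis less_le subsetD)
    then have "X.mball x r = X.mcball x r"
      using x by auto
    then have "closedin X.mtopology (X.mball x r)"
      by simp
    moreover have "X.mball x r \<subseteq> W"
      using e r by (intro order_trans[OF X.mball_subset_concentric e(2)]) simp
    ultimately show ?thesis
      using x \<open>0 < r\<close> by (intro exI[of _ "X.mball x r"]) simp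
  qed
  then show ?thesis
    unfolding zero_dimensional_def dim_le_0_iff mtopology_of_def by simp
qed

text \<open>If the strong inequality fails, the long side exceeds each of the other two, hence twice
  each of them, hence their sum.\<close>

lemma ultrametric_if_well_spaced:
  assumes "well_spaced A" "dist_set X \<subseteq> A"
  shows "ultrametric X"
  unfolding ultrametric_def
proof (intro ballI, rule ccontr)
  fix x y z assume *: "x \<in> mspace X" "y \<in> mspace X" "z \<in> mspace X"
    "\<not> mdist X x z \<le> max (mdist X x y) (mdist X y z)"
  have "mdist X x y \<in> A" "mdist X y z \<in> A" "mdist X x z \<in> A"
    using * by (auto intro!: subsetD[OF assms(2)] dist_setI)
  then have "2 * mdist X x y < mdist X x z" "2 * mdist X y z < mdist X x z"
    using assms(1) * unfolding well_spaced_def by auto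
  then show False
    using mdist_triangle[of x X y z] * by linarith
qed

lemma ultrametric_isometric_on:
  assumes g: "isometric_on (mspace Y) Y Z g" and Z: "ultrametric Z"
  shows "ultrametric Y"
  unfolding ultrametric_def
proof (intro ballI)
  have iso: "\<And>x y. x \<in> mspace Y \<Longrightarrow> y \<in> mspace Y \<Longrightarrow> mdist Z (g x) (g y) = mdist Y x y"
    and mem: "\<And>x. x \<in> mspace Y \<Longrightarrow> g x \<in> mspace Z"
    using g unfolding isometric_on_def by auto
  fix x y z assume xyz: "x \<in> mspace Y" "y \<in> mspace Y" "z \<in> mspace Y"
  have "mdist Z (g x) (g z) \<le> max (mdist Z (g x) (g y)) (mdist Z (g y) (g z))"
    using Z mem[OF xyz(1)] mem[OF xyz(2)] mem[OF xyz(3)] unfolding ultrametric_def by simp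
  then show "mdist Y x z \<le> max (mdist Y x y) (mdist Y y z)"
    using xyz by (simp add: iso)
qed

text \<open>Isolation concerns \<open>A\<close> alone, so the gap \<open>e\<close> is the same at
  every point of \<open>X\<close>.\<close>

lemma uniformly_discrete_if_isolated:
  assumes "0 isolated_in A" "dist_set X \<subseteq> (A :: real set)"
  obtains e where "e > 0"
    "\<And>x y. x \<in> mspace X \<Longrightarrow> y \<in> mspace X \<Longrightarrow> x \<noteq> y \<Longrightarrow> e \<le> mdist X x y"
proof -
  obtain e where e: "e > 0" "\<And>r. r \<in> A \<Longrightarrow> dist 0 r < e \<Longrightarrow> r = 0"
    using assms(1) unfolding isolated_in_dist_Ex_iff by blast
  show ?thesis
  proof (rule that[OF e(1)], rule ccontr)
    fix x y assume xy: "x \<in> mspace X" "y \<in> mspace X" "x \<noteq> y" "\<not> e \<le> mdist X x y"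
    then show False
      using e(2)[of "mdist X x y"] dist_setI[of x X y] assms(2) by auto
  qed
qed

text \<open>Two points of \<open>S\<close> at distance at least \<open>e\<close> cannot both be
  within \<open>e / 2\<close> of one point of a countable dense set, so choosing such a point is
  injective.\<close>

lemma countable_if_uniformly_discrete:
  assumes "separable_space (mtopology_of U)" "S \<subseteq> mspace U" "e > 0"
    and sep: "\<And>x y. x \<in> S \<Longrightarrow> y \<in> S \<Longrightarrow> x \<noteq> y \<Longrightarrow> e \<le> mdist U x y"
  shows "countable S"
proof -
  obtain C where C: "C \<subseteq> mspace U" "countable C"
    "\<And>x e. x \<in> mspace U \<Longrightarrow> e > 0 \<Longrightarrow> \<exists>c\<in>C. mdist U x c < e"
    using assms(1) unfolding separable_mtopology_of_iff by blast
  have "\<exists>c\<in>C. mdist U x c < e / 2" if "x \<in> S" for x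
    using C(3)[of x "e / 2"] that assms(2,3) by auto
  then obtain c where c: "\<And>x. x \<in> S \<Longrightarrow> c x \<in> C" "\<And>x. x \<in> S \<Longrightarrow> mdist U x (c x) < e / 2"
    by metis
  have "inj_on c S"
  proof (rule inj_onI, rule ccontr)
    fix x y assume xy: "x \<in> S" "y \<in> S" "c x = c y" "x \<noteq> y"
    have "mdist U x y \<le> mdist U x (c x) + mdist U (c x) y"
      using xy c(1) C(1) assms(2) by (intro mdist_triangle) auto
    then show False
      using c(2)[OF xy(1)] c(2)[OF xy(2)] xy(3) sep[OF xy(1,2,4)] mdist_commute[of U y "c y"]
      by simp
  qed
  moreover have "c ` S \<subseteq> C" using c(1) by blast
  ultimately show ?thesis
    using C(2) countable_image_inj_on countable_subset by blast
qed

lemma sigma_compact_space_countable: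
  assumes "countable (topspace T)" "topspace T \<noteq> {}"
  shows "sigma_compact_space T"
  unfolding sigma_compact_space_def
proof (intro exI conjI allI)
  \<comment> \<open>For a finite space the surplus indices are sent to some point of the space; this
    is where nonemptiness enters.\<close>
  show "topspace T = (\<Union>n. {from_nat_into (topspace T) n})"
    using range_from_nat_into[OF assms(2,1)] by blast
  show "compactin T {from_nat_into (topspace T) n}" for n
    using from_nat_into[OF assms(2)] by simp
qed

section \<open>Test spaces\<close>

lemma polish_metric_interval:
  assumes "r \<ge> (0::real)"
  shows "polish_metric (submetric euclidean_metric {0..r})"
  unfolding polish_metric_def
proof (intro conjI)
  show "separable_space (mtopology_of (submetric euclidean_metric {0..r}))"
  proof -
    obtain C where C: "countable C" "C \<subseteq> {0..r}" "{0..r} \<subseteq> closure C"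
      using separable .
    have "\<exists>c\<in>C. dist x c < e" if "x \<in> {0..r}" "e > 0" for x e
      using subsetD[OF C(3) that(1)] that(2) unfolding closure_approachable
      by (metis dist_commute)
    then show ?thesis
      unfolding separable_mtopology_of_iff using C(1,2) by (intro exI[of _ C]) simp
  qed
  have "complete {0..r}" by (simp add: complete_eq_closed)
  then show "mcomplete_of (submetric euclidean_metric {0..r})"
    unfolding mcomplete_of_iff complete_def Cauchy_def lim_sequentially by simp
qed (use assms in auto)

lemma dist_set_interval: "dist_set (submetric euclidean_metric {0..r::real}) \<subseteq> {0..r}"
  unfolding dist_set_def by (auto simp: dist_real_def)

lemma not_zero_dimensional_interval:
  assumes "r > (0::real)"
  shows "\<not> mtopology_of (submetric euclidean_metric {0..r}) dim_le 0"
proof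
  let ?T = "top_of_set {0..r}"
  assume "mtopology_of (submetric euclidean_metric {0..r}) dim_le 0"
  then have nb: "?T dim_le 0"
    unfolding mtopology_of_submetric mtopology_of_euclidean .
  \<comment> \<open>A neighbourhood of \<open>0\<close> that omits \<open>r\<close>: a clopen set
    between \<open>0\<close> and it would split the connected interval.\<close>
  have "openin ?T ({0..r} \<inter> {..<r})" by (intro openin_open_Int open_lessThan)
  moreover have "0 \<in> {0..r} \<inter> {..<r}" using assms by simp
  ultimately obtain B where B: "closedin ?T B" "openin ?T B" "0 \<in> B" "B \<subseteq> {0..r} \<inter> {..<r}"
    using nb[unfolded dim_le_0_iff, THEN spec[of _ "{0..r} \<inter> {..<r}"], THEN spec[of _ 0], THEN mp]
    by blast
  have "B = {} \<or> B = {0..r}"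
    using B(1,2) connected_Icc[of 0 r] unfolding connected_clopen by blast
  then show False
    using B(3,4) assms by auto
qed

text \<open>An isosceles triangle with apex \<open>1\<close>, legs \<open>r\<close> and base
  \<open>s\<close>.\<close>

definition three_point :: "real \<Rightarrow> real \<Rightarrow> nat metric" where
  "three_point r s =
     metric ({0, 1, 2}, \<lambda>i j. if i = j then 0 else if i = 1 \<or> j = 1 then r else s)"

text \<open>\<open>s \<le> 2 * r\<close> is the triangle inequality for the base, and
  \<open>r < s\<close> makes the base longer than both legs, against the strong inequality.\<close>

lemma three_point:
  assumes "0 < r" "r < s" "s \<le> 2 * r"
  shows "polish_metric (three_point r s)" "dist_set (three_point r s) \<subseteq> {0, r, s}"
    "\<not> ultrametric (three_point r s)"
proof -
  have M: "Metric_space {0, 1, 2::nat} (\<lambda>i j. if i = j then 0 else if i = 1 \<or> j = 1 then r else s)"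
    by unfold_locales (use assms in auto)
  have [simp]: "mspace (three_point r s) = {0, 1, 2}"
    "mdist (three_point r s) = (\<lambda>i j. if i = j then 0 else if i = 1 \<or> j = 1 then r else s)"
    unfolding three_point_def
    using Metric_space.mspace_metric[OF M] Metric_space.mdist_metric[OF M] by auto
  show "polish_metric (three_point r s)"
    by (rule polish_metric_uniformly_discrete[of r]) (use assms in auto)
  show "dist_set (three_point r s) \<subseteq> {0, r, s}"
    unfolding dist_set_def by auto
  show "\<not> ultrametric (three_point r s)"
    unfolding ultrametric_def using assms by auto
qed

text \<open>Infinite and discrete, hence neither compact nor connected: one test space for both
  properties.\<close>

definition equilateral :: "real \<Rightarrow> nat metric" where
  "equilateral c = metric (UNIV, \<lambda>i j. if i = j then 0 else c)"

lemma equilateral: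
  assumes "c > 0"
  shows "polish_metric (equilateral c)" "dist_set (equilateral c) \<subseteq> {0, c}"
    "mtopology_of (equilateral c) = discrete_topology UNIV"
proof -
  have M: "Metric_space (UNIV :: nat set) (\<lambda>i j. if i = j then 0 else c)"
    by unfold_locales (use assms in auto)
  have [simp]: "mspace (equilateral c) = UNIV"
    "mdist (equilateral c) = (\<lambda>i j. if i = j then 0 else c)"
    unfolding equilateral_def
    using Metric_space.mspace_metric[OF M] Metric_space.mdist_metric[OF M] by auto
  show "polish_metric (equilateral c)"
    by (rule polish_metric_uniformly_discrete[of c]) (use assms in auto)
  show "dist_set (equilateral c) \<subseteq> {0, c}"
    unfolding dist_set_def by auto
  show "mtopology_of (equilateral c) = discrete_topology UNIV"
    using mtopology_of_eq_discrete[of c "equilateral c"] assms by simp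
qed

section \<open>The Baire space with prescribed distances\<close>

locale baire_metric =
  fixes a :: "nat \<Rightarrow> real"
  assumes pos: "\<And>n. 0 < a n"
    and decreasing: "\<And>m n. m < n \<Longrightarrow> a n < a m"
    and null: "a \<longlonglongrightarrow> 0"
begin

definition bdist :: "(nat \<Rightarrow> nat) \<Rightarrow> (nat \<Rightarrow> nat) \<Rightarrow> real" where
  "bdist x y = (if x = y then 0 else a (LEAST n. x n \<noteq> y n))"

definition baire :: "(nat \<Rightarrow> nat) metric" where
  "baire = metric (UNIV, bdist)"

text \<open>Closed balls of radius \<open>a n\<close> are cylinders: by strict decrease, a distance
  of at most \<open>a n\<close> means that the first difference is at index \<open>n\<close> or
  later. The metric arguments below are read off from this.\<close>

lemma bdist_le_iff: "bdist x y \<le> a n \<longleftrightarrow> (\<forall>i<n. x i = y i)"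
proof (cases "x = y")
  case False
  define k where "k = (LEAST n. x n \<noteq> y n)"
  have "\<exists>n. x n \<noteq> y n"
    using False by (simp add: fun_eq_iff)
  then have "x k \<noteq> y k"
    unfolding k_def by (rule LeastI_ex)
  moreover have "x i = y i" if "i < k" for i
    using not_less_Least[OF that[unfolded k_def]] by simp
  moreover have "a k \<le> a n \<longleftrightarrow> n \<le> k"
    using decreasing[of n k] decreasing[of k n] by (cases n k rule: linorder_cases) auto
  moreover have "bdist x y = a k"
    using False unfolding bdist_def k_def by simp
  ultimately show ?thesis
    by (metis less_le_trans linorder_not_less)
qed (use pos[of n] in \<open>simp add: bdist_def\<close>)

lemma bdist_cases: "x \<noteq> y \<Longrightarrow> \<exists>n. bdist x y = a n"
  unfolding bdist_def by auto

lemma bdist_zero_iff: "bdist x y = 0 \<longleftrightarrow> x = y"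
  using pos[of "LEAST n. x n \<noteq> y n"] unfolding bdist_def by simp

lemma bdist_nonneg: "0 \<le> bdist x y"
  using pos unfolding bdist_def by (simp add: less_imp_le)

text \<open>With \<open>a m\<close> the larger distance on the right, both pairs agree below
  \<open>m\<close>, and agreement is transitive.\<close>

lemma bdist_ultra: "bdist x z \<le> max (bdist x y) (bdist y z)"
proof (cases "x = y \<or> y = z")
  case False
  obtain m where m: "max (bdist x y) (bdist y z) = a m"
    using False bdist_cases[of x y] bdist_cases[of y z] unfolding max_def by metis
  then have "bdist x y \<le> a m" "bdist y z \<le> a m"
    by (metis max.cobounded1, metis max.cobounded2)
  then show ?thesis
    unfolding m bdist_le_iff by simp
qed auto

lemma Metric_space_bdist: "Metric_space UNIV bdist"
proof
  show "bdist x y = bdist y x" for x y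
    by (simp add: bdist_def eq_commute)
  show "bdist x z \<le> bdist x y + bdist y z" for x y z
    using bdist_ultra[of x z y] bdist_nonneg[of x y] bdist_nonneg[of y z] by linarith
qed (auto simp: bdist_zero_iff bdist_nonneg)

sublocale B: Metric_space UNIV bdist
  by (rule Metric_space_bdist)

lemma mspace_baire [simp]: "mspace baire = UNIV"
  and mdist_baire [simp]: "mdist baire = bdist"
  and mtopology_of_baire [simp]: "mtopology_of baire = B.mtopology"
  unfolding baire_def by simp_all

lemma dist_set_baire: "dist_set baire \<subseteq> insert 0 (range a)"
  by (auto simp: dist_set_def bdist_def)

lemma small_radius:
  assumes "e > 0"
  shows "\<exists>n. a n < e"
  using order_tendstoD(2)[OF null assms] eventually_sequentially by auto

lemma polish_metric_baire: "polish_metric baire"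
  unfolding polish_metric_def
proof (intro conjI)
  \<comment> \<open>Finite lists padded with zeros: a countable set of sequences that meets every
    cylinder.\<close>
  define F where "F l i = (if i < length l then l ! i else 0)" for l :: "nat list" and i
  have "\<exists>c\<in>range F. bdist x c < e" if "e > 0" for x e
  proof -
    obtain n where n: "a n < e" using small_radius[OF \<open>e > 0\<close>] ..
    have "bdist x (F (map x [0..<n])) \<le> a n"
      unfolding bdist_le_iff F_def by simp
    then show ?thesis using n by (intro bexI[of _ "F (map x [0..<n])"]) auto
  qed
  then show "separable_space (mtopology_of baire)"
    unfolding separable_mtopology_of_iff by (intro exI[of _ "range F"]) simp
  show "mcomplete_of baire"
    unfolding mcomplete_of_iff
  proof (intro allI impI)
    fix s :: "nat \<Rightarrow> _" assume s: "(\<forall>n. s n \<in> mspace baire) \<and>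
      (\<forall>e>0. \<exists>N. \<forall>m\<ge>N. \<forall>n\<ge>N. mdist baire (s m) (s n) < e)"
    then have "\<forall>k. \<exists>N. \<forall>m\<ge>N. \<forall>n\<ge>N. bdist (s m) (s n) < a k"
      using pos by simp
    then obtain N where N0: "\<forall>k. \<forall>m\<ge>N k. \<forall>n\<ge>N k. bdist (s m) (s n) < a k"
      by (rule choice[THEN exE])
    have N: "s m i = s n i" if "m \<ge> N k" "n \<ge> N k" "i < k" for k m n i
    proof -
      have "bdist (s m) (s n) \<le> a k"
        using N0 that(1,2) by (simp add: less_imp_le)
      then show ?thesis
        using that(3) by (simp add: bdist_le_iff)
    qed
    \<comment> \<open>Distance at most \<open>a k\<close> fixes only the coordinates strictly below
      \<open>k\<close>, so coordinate \<open>i\<close> is settled from \<open>N (Suc i)\<close>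
      on.\<close>
    define l where "l i = s (N (Suc i)) i" for i
    have "\<exists>M. \<forall>n\<ge>M. bdist (s n) l < e" if "e > 0" for e
    proof -
      obtain k where k: "a k < e" using small_radius[OF \<open>e > 0\<close>] ..
      have "bdist (s n) l \<le> a k" if "n \<ge> N k" for n
        unfolding bdist_le_iff
      proof (intro allI impI)
        fix i assume "i < k"
        \<comment> \<open>\<open>N\<close> need not be monotone; the maximum is an index at which
          both stability statements apply.\<close>
        have "s n i = s (max (N k) (N (Suc i))) i"
          by (rule N[of k]) (use that \<open>i < k\<close> in auto)
        also have "\<dots> = l i"
          unfolding l_def by (rule N[of "Suc i"]) auto
        finally show "s n i = l i" .
      qed
      then show ?thesis using k le_less_trans by blast
    qed
    then show "\<exists>l\<in>mspace baire. \<forall>e>0. \<exists>N. \<forall>n\<ge>N. mdist baire (s n) l < e"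
      by auto
  qed
qed simp

text \<open>Every ball contains an infinite set of points at a common distance \<open>a n\<close>.\<close>

lemma interior_of_compactin_baire:
  assumes "compactin B.mtopology K"
  shows "B.mtopology interior_of K = {}"
proof (rule ccontr)
  assume "B.mtopology interior_of K \<noteq> {}"
  then obtain x where "x \<in> B.mtopology interior_of K"
    by blast
  then obtain e where e: "e > 0" "B.mball x e \<subseteq> K"
    using openin_interior_of[of B.mtopology K] interior_of_subset[of B.mtopology K]
    unfolding B.openin_mtopology by (meson subset_trans)
  obtain n where n: "a n < e" using small_radius[OF e(1)] ..
  \<comment> \<open>These points agree with \<open>x\<close> below \<open>n\<close>, so they stay in
    the ball, but any two of them differ at \<open>n\<close>.\<close>
  define s where "s k = x(n := k)" for k
  have "bdist x (s k) \<le> a n" for k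
    unfolding bdist_le_iff s_def by simp
  then have "range s \<subseteq> K"
    using n e(2) by (fastforce intro: le_less_trans)
  then obtain l r where lr: "strict_mono (r :: nat \<Rightarrow> nat)"
    "limitin B.mtopology (s \<circ> r) l sequentially"
    using assms unfolding B.compactin_sequentially by blast
  then have "B.MCauchy (s \<circ> r)"
    using B.convergent_imp_MCauchy by blast
  then obtain N where "\<forall>i j. N \<le> i \<longrightarrow> N \<le> j \<longrightarrow> bdist (s (r i)) (s (r j)) < a (Suc n)"
    unfolding B.MCauchy_def using pos by (metis comp_apply)
  \<comment> \<open>Radius \<open>a (Suc n)\<close> forces agreement at coordinate \<open>n\<close>
    itself, where the two sequences take the values \<open>r N\<close> and
    \<open>r (Suc N)\<close>.\<close>
  then have "bdist (s (r N)) (s (r (Suc N))) \<le> a (Suc n)"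
    by (simp add: less_imp_le)
  then have "r N = r (Suc N)"
    unfolding bdist_le_iff s_def by auto
  then show False
    using lr(1) by (metis lessI less_irrefl strict_mono_less)
qed

lemma not_locally_compact_baire: "\<not> locally_compact_space (mtopology_of baire)"
proof
  assume "locally_compact_space (mtopology_of baire)"
  then obtain V K where "openin B.mtopology V" "compactin B.mtopology K"
    "(\<lambda>_. 0) \<in> V" "V \<subseteq> K"
    unfolding locally_compact_space_def
    by (metis UNIV_I mspace_baire mtopology_of_baire topspace_mtopology_of)
  then have "(\<lambda>_. 0) \<in> B.mtopology interior_of K"
    using interior_of_maximal by blast
  then show False
    using interior_of_compactin_baire \<open>compactin B.mtopology K\<close> by auto
qed

text \<open>Compact sets are closed with empty interior here, so by the Baire category theorem
  countably many of them cannot cover the complete space.\<close>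

lemma not_sigma_compact_baire: "\<not> sigma_compact_space (mtopology_of baire)"
proof
  assume "sigma_compact_space (mtopology_of baire)"
  then obtain K where K: "\<And>n::nat. compactin B.mtopology (K n)" "UNIV = (\<Union>n. K n)"
    unfolding sigma_compact_space_def by auto
  have "B.mcomplete"
    using polish_metric_baire unfolding polish_metric_def mcomplete_of_def by simp
  then have "B.mtopology interior_of \<Union> (range K) = {}"
    using K(1) interior_of_compactin_baire compactin_imp_closedin[OF B.Hausdorff_space_mtopology]
    by (intro B.metric_Baire_category_alt) auto
  then show False
    using interior_of_topspace[of B.mtopology] K(2) by simp
qed

end

lemma obtain_baire_metric:
  assumes nonneg: "\<And>r. r \<in> A \<Longrightarrow> 0 \<le> r" and "0 \<in> A" "\<not> 0 isolated_in (A :: real set)"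
  obtains a where "baire_metric a" "range a \<subseteq> A"
proof -
  have ex: "\<exists>r\<in>A. 0 < r \<and> r < e" if "e > 0" for e
  proof -
    obtain r where "r \<in> A" "dist 0 r < e" "r \<noteq> 0"
      using assms(2,3) \<open>e > 0\<close> unfolding isolated_in_dist_Ex_iff by blast
    then show ?thesis using nonneg[of r] by (intro bexI[of _ r]) auto
  qed
  have "\<exists>a. \<forall>n. (a n \<in> A \<and> 0 < a n \<and> a n < inverse (real (Suc n))) \<and> a (Suc n) < a n"
  proof (rule dependent_nat_choice)
    show "\<exists>x. x \<in> A \<and> 0 < x \<and> x < inverse (real (Suc 0))"
      using ex[of 1] by auto
    fix x n assume "x \<in> A \<and> 0 < x \<and> x < inverse (real (Suc n))"
    then show "\<exists>y. (y \<in> A \<and> 0 < y \<and> y < inverse (real (Suc (Suc n)))) \<and> y < x"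
      \<comment> \<open>The two bounds in the minimum secure strict decrease and convergence to
        \<open>0\<close>, respectively.\<close>
      using ex[of "min x (inverse (real (Suc (Suc n))))"] by auto
  qed
  then obtain a where a: "\<And>n. a n \<in> A" "\<And>n. 0 < a n" "\<And>n. a n < inverse (real (Suc n))"
    "\<And>n. a (Suc n) < a n"
    by blast
  have "a \<longlonglongrightarrow> 0"
    by (rule tendsto_sandwich[OF _ _ tendsto_const LIMSEQ_inverse_real_of_nat])
       (use a in \<open>auto intro!: always_eventually less_imp_le\<close>)
  moreover have "a n < a m" if "m < n" for m n
    using lift_Suc_mono_less[of "\<lambda>n. - a n", OF _ that] a(4) by simp
  ultimately have "baire_metric a"
    using a(2) by unfold_locales auto
  then show ?thesis using that a(1) by blast
qed

theorem theorem3p6: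
  fixes U :: "'u metric" and A :: "real set"
  assumes "urysohn_space U"
    and "distance_set A"
  shows "\<forall>\<V> \<in> {dist_eq U A, dist_sub U A}.
    ((\<forall>X\<in>\<V>. zero_dimensional (submetric U X)) \<longleftrightarrow> \<not> (\<exists>r>0. {0..r} \<subseteq> A)) \<and>
    ((\<forall>X\<in>\<V>. ultrametric (submetric U X)) \<longleftrightarrow> well_spaced A) \<and>
    (((\<forall>X\<in>\<V>. discrete_metric_space (submetric U X)) \<longleftrightarrow>
        (\<forall>X\<in>\<V>. locally_compact_space (mtopology_of (submetric U X)))) \<and>
     ((\<forall>X\<in>\<V>. locally_compact_space (mtopology_of (submetric U X))) \<longleftrightarrow>
        (\<forall>X\<in>\<V>. sigma_compact_space (mtopology_of (submetric U X)))) \<and>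
     ((\<forall>X\<in>\<V>. sigma_compact_space (mtopology_of (submetric U X))) \<longleftrightarrow> 0 isolated_in A)) \<and>
    (((\<forall>X\<in>\<V>. connected_space (mtopology_of (submetric U X))) \<longleftrightarrow>
        (\<forall>X\<in>\<V>. compact_space (mtopology_of (submetric U X)))) \<and>
     ((\<forall>X\<in>\<V>. compact_space (mtopology_of (submetric U X))) \<longleftrightarrow>
        (\<forall>X\<in>\<V>. \<exists>x. X = {x})) \<and>
     ((\<forall>X\<in>\<V>. \<exists>x. X = {x}) \<longleftrightarrow> A = {0}))"
proof (rule ballI, goal_cases)
  case \<V>: (1 \<V>)
  obtain X0 :: "real metric" where X0: "polish_metric X0" "A = dist_set X0"
    using assms(2) unfolding distance_set_def by blast
  have A0: "0 \<in> A" and Apos: "\<And>r. r \<in> A \<Longrightarrow> 0 \<le> r"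
    using X0 zero_in_dist_set[of _ X0] dist_set_nonneg[of _ X0]
    unfolding polish_metric_def by auto
  have sep: "separable_space (mtopology_of U)"
    using assms(1) unfolding urysohn_space_def polish_metric_def by blast
  \<comment> \<open>Both choices of \<open>\<V>\<close> are treated at once: counterexamples are
    built inside \<open>dist_eq U A\<close>, while positive results use only that the distances of
    \<open>X\<close> lie in \<open>A\<close>.\<close>
  have eq: "dist_eq U A \<subseteq> \<V>"
    using \<V> unfolding dist_eq_def dist_sub_def by auto
  have DX: "dist_set (submetric U X) \<subseteq> A" and ne: "X \<noteq> {}" and mX: "mspace (submetric U X) = X"
    if "X \<in> \<V>" for X
    using that \<V> closedin_subset[of "mtopology_of U" X]
    unfolding dist_eq_def dist_sub_def closed_subspaces_def by auto
  have retr: "\<exists>S\<in>\<V>. \<exists>p g. isometric_on (mspace Y) Y (submetric U S) g \<and>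
      retraction_maps (mtopology_of (submetric U S)) (mtopology_of Y) p g"
    if "polish_metric Y" "dist_set Y \<subseteq> A" for Y :: "'y metric"
    using dist_eq_retraction[OF assms(1) X0(1) that(1)] that(2) eq X0(2) by blast

  \<comment> \<open>Zero-dimensionality and right neighbourhoods of \<open>0\<close>\<close>
  have z1: "zero_dimensional (submetric U X)" if "\<not> (\<exists>r>0. {0..r} \<subseteq> A)" "X \<in> \<V>" for X
    using zero_dimensional_if_no_interval[OF that(1)] DX[OF that(2)] by blast
  have z2: False if r: "r > 0" "{0..r} \<subseteq> A" and all: "\<forall>X\<in>\<V>. zero_dimensional (submetric U X)" for r
  proof -
    let ?Y = "submetric euclidean_metric {0..r}"
    have "polish_metric ?Y" using r polish_metric_interval by simp
    moreover have "dist_set ?Y \<subseteq> A" using dist_set_interval r(2) by blast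
    ultimately obtain S p g where "S \<in> \<V>"
      "retraction_maps (mtopology_of (submetric U S)) (mtopology_of ?Y) p g"
      using retr by blast
    then have "mtopology_of ?Y dim_le 0"
      using all dimension_le_retraction_map_image
      unfolding zero_dimensional_def retraction_map_def by blast
    then show False using not_zero_dimensional_interval r(1) by blast
  qed

  \<comment> \<open>Ultrametric spaces and well-spaced sets\<close>
  have u1: "ultrametric (submetric U X)" if "well_spaced A" "X \<in> \<V>" for X
    using ultrametric_if_well_spaced[OF that(1)] DX[OF that(2)] by blast
  have u2: "well_spaced A" if all: "\<forall>X\<in>\<V>. ultrametric (submetric U X)"
    unfolding well_spaced_def
  proof (intro ballI impI, rule ccontr)
    fix r s assume rs: "r \<in> A" "s \<in> A" "r < s" "\<not> 2 * r < s"
    \<comment> \<open>For \<open>r = 0\<close> the inequality \<open>2 * r < s\<close> would be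
      \<open>r < s\<close> itself, so a violating pair has \<open>r > 0\<close>.\<close>
    then have rs': "0 < r" "r < s" "s \<le> 2 * r"
      using Apos[of r] by auto
    have "dist_set (three_point r s) \<subseteq> A"
      using three_point(2)[OF rs'] rs A0 by blast
    then obtain S g where S: "S \<in> \<V>"
      and g: "isometric_on (mspace (three_point r s)) (three_point r s) (submetric U S) g"
      using retr three_point(1)[OF rs'] by blast
    have "ultrametric (submetric U S)" using all S by blast
    then have "ultrametric (three_point r s)"
      by (rule ultrametric_isometric_on[OF g])
    then show False using three_point(3)[OF rs'] by blast
  qed

  \<comment> \<open>Discreteness, local compactness and sigma-compactness\<close>
  have d1: "mtopology_of (submetric U X) = discrete_topology X" "countable X"
    if "0 isolated_in A" "X \<in> \<V>" for X
  proof -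
    obtain e where e: "e > 0" "\<And>x y. x \<in> X \<Longrightarrow> y \<in> X \<Longrightarrow> x \<noteq> y \<Longrightarrow> e \<le> mdist U x y"
      using uniformly_discrete_if_isolated[OF \<open>0 isolated_in A\<close> DX[OF \<open>X \<in> \<V>\<close>]]
      unfolding mX[OF \<open>X \<in> \<V>\<close>] mdist_submetric by blast
    show "mtopology_of (submetric U X) = discrete_topology X"
      using mtopology_of_eq_discrete[OF e(1), of "submetric U X"] e(2) mX[OF that(2)] by simp
    show "countable X"
      using mX[OF that(2)] countable_if_uniformly_discrete[OF sep _ e] by auto
  qed
  have d2: "discrete_metric_space (submetric U X)"
    "locally_compact_space (mtopology_of (submetric U X))"
    "sigma_compact_space (mtopology_of (submetric U X))" if "0 isolated_in A" "X \<in> \<V>" for X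
    using d1[OF that] mX[OF that(2)] ne[OF that(2)]
    by (auto simp: discrete_metric_space_def locally_compact_space_discrete_topology
        intro: sigma_compact_space_countable)
  \<comment> \<open>Consequently a member of \<open>\<V>\<close> that is not locally compact also
    refutes discreteness.\<close>
  have d3: "locally_compact_space (mtopology_of (submetric U X))"
    if "discrete_metric_space (submetric U X)" for X
    using that unfolding discrete_metric_space_def
    by (simp add: locally_compact_space_discrete_topology)
  have d4: "\<exists>S\<in>\<V>. \<not> locally_compact_space (mtopology_of (submetric U S)) \<and>
      \<not> sigma_compact_space (mtopology_of (submetric U S))" if not_isolated: "\<not> 0 isolated_in A"
  proof -
    obtain a where a: "baire_metric a" "range a \<subseteq> A"
      using obtain_baire_metric[OF Apos A0 not_isolated] by blast
    interpret baire_metric a by (rule a(1))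
    have "dist_set baire \<subseteq> A" using dist_set_baire a(2) A0 by blast
    then obtain S p g where S: "S \<in> \<V>"
      "retraction_maps (mtopology_of (submetric U S)) (mtopology_of baire) p g"
      using retr polish_metric_baire by blast
    then have p: "retraction_map (mtopology_of (submetric U S)) (mtopology_of baire) p"
      unfolding retraction_map_def by blast
    note q = retraction_imp_quotient_map[OF p]
    have "\<not> locally_compact_space (mtopology_of (submetric U S))"
      using locally_compact_space_retraction_map_image[OF p] not_locally_compact_baire by blast
    moreover have "\<not> sigma_compact_space (mtopology_of (submetric U S))"
      using sigma_compact_space_continuous_map_image[OF _ quotient_imp_continuous_map[OF q]
          quotient_imp_surjective_map[OF q]] not_sigma_compact_baire by blast
    ultimately show ?thesis
      using S(1) by blast
  qed

  \<comment> \<open>Connectedness, compactness and singletons\<close>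
  have c1: "\<exists>x. X = {x}" if "A = {0}" "X \<in> \<V>" for X
  proof -
    obtain x where x: "x \<in> X" using ne[OF \<open>X \<in> \<V>\<close>] by blast
    have "y = x" if y: "y \<in> X" for y
      using dist_setI[of x "submetric U X" y] DX[OF \<open>X \<in> \<V>\<close>] x y mX[OF \<open>X \<in> \<V>\<close>] \<open>A = {0}\<close>
        mdist_zero[of x "submetric U X" y] by auto
    then show ?thesis using x by blast
  qed
  have c2: "compact_space (mtopology_of (submetric U X))"
    "connected_space (mtopology_of (submetric U X))" if "\<exists>x. X = {x}" "X \<in> \<V>" for X
  proof -
    obtain x where "X = {x}"
      using \<open>\<exists>x. X = {x}\<close> by blast
    have x: "topspace (mtopology_of (submetric U X)) = {x}"
      using mX[OF that(2)] \<open>X = {x}\<close> by simp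
    show "compact_space (mtopology_of (submetric U X))"
      unfolding compact_space_def x using finite_imp_compactin[of "{x}"] x by (metis finite.emptyI finite.insertI order_refl)
    show "connected_space (mtopology_of (submetric U X))"
      unfolding connectedin_topspace[symmetric] x connectedin_sing by simp
  qed
  have c3: "\<exists>S\<in>\<V>. \<not> connected_space (mtopology_of (submetric U S)) \<and>
      \<not> compact_space (mtopology_of (submetric U S))" if "A \<noteq> {0}"
  proof -
    obtain c where "c \<in> A" "c \<noteq> 0"
      using \<open>A \<noteq> {0}\<close> A0 by blast
    then have c: "c \<in> A" "c > 0"
      using Apos[of c] by auto
    then have "dist_set (equilateral c) \<subseteq> A"
      using equilateral(2) A0 by blast
    then obtain S p g where S: "S \<in> \<V>"
      "retraction_maps (mtopology_of (submetric U S)) (mtopology_of (equilateral c)) p g"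
      using retr equilateral(1)[OF c(2)] by blast
    then have p: "retraction_map (mtopology_of (submetric U S)) (discrete_topology UNIV) p"
      unfolding retraction_map_def equilateral(3)[OF c(2)] by blast
    note q = retraction_imp_quotient_map[OF p]
    have "\<not> compact_space (discrete_topology (UNIV :: nat set))"
      by (simp add: compact_space_discrete_topology)
    then have "\<not> compact_space (mtopology_of (submetric U S))"
      using image_compactin[OF _ quotient_imp_continuous_map[OF q]]
        quotient_imp_surjective_map[OF q] unfolding compact_space_def by metis
    moreover have "\<not> connected_space (discrete_topology (UNIV :: nat set))"
      unfolding connected_space_discrete_topology by (metis finite.emptyI finite.insertI finite_subset infinite_UNIV_nat)
    then have "\<not> connected_space (mtopology_of (submetric U S))"
      using connected_space_retraction_map_image[OF p] by blast
    ultimately show ?thesis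
      using S(1) by blast
  qed
  \<comment> \<open>The equivalences close in two cycles: \<open>A = {0}\<close> gives singletons,
    singletons are compact and connected, and either property for all members of \<open>\<V>\<close>
    gives back \<open>A = {0}\<close>.\<close>
  have s1: "\<forall>X\<in>\<V>. \<exists>x. X = {x}" if "A = {0}"
    using c1[OF that] by blast
  have s2: "\<forall>X\<in>\<V>. compact_space (mtopology_of (submetric U X))"
    "\<forall>X\<in>\<V>. connected_space (mtopology_of (submetric U X))" if "\<forall>X\<in>\<V>. \<exists>x. X = {x}"
    using c2 that by simp_all
  have s3: "A = {0}" if "\<forall>X\<in>\<V>. compact_space (mtopology_of (submetric U X))"
    using c3 that by (metis (no_types))
  have s4: "A = {0}" if "\<forall>X\<in>\<V>. connected_space (mtopology_of (submetric U X))"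
    using c3 that by (metis (no_types))
  show ?case
  proof (intro conjI, goal_cases)
    case 1 show ?case using z1 z2 by blast
  next
    case 2 show ?case using u1 u2 by blast
  next
    case 3 show ?case using d2 d3 d4 by blast
  next
    case 4 show ?case using d2 d4 by blast
  next
    case 5 show ?case using d2 d4 by blast
  next
    case 6 show ?case using s1 s2 s4 s3 by (intro iffI) simp_all
  next
    case 7 show ?case using s1 s2(1) s3 by (intro iffI) simp_all
  next
    case 8 show ?case using s1 s2(1) s3 by (intro iffI) simp_all
  qed
qed

end
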